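(* Let $q\ge 6$ be a prime power. A ruled quintic surface $\mathcal V$ of $\mathrm{PG}(6,q)$ contains exactly $q^2$ twisted cubics, and each of them is a directrix of $\mathcal V$, i.e. each lies in a $3$-space disjoint from the plane $\alpha$ of the conic directrix and contains exactly one point of each generator of $\mathcal V$.
   Context: Construction: in $\mathrm{PG}(6,q)$ let $\alpha$ be a plane and $\Pi_3$ a $3$-space with $\alpha\cap\Pi_3=\emptyset$. Let $\mathcal C$ be a non-degenerate conic in $\alpha$ and $\mathcal N_3$ a twisted cubic in $\Pi_3$, parametrised as $\mathcal C=\{(1,\theta,\theta^2)\}$ and $\mathcal N_3=\{(1,\epsilon,\epsilon^2,\epsilon^3)\}$ ($\theta,\epsilon\in\mathbb F_q\cup\{\infty\}$), and let $\phi\in\mathrm{PGL}(2,q)$ act on parameters, giving a bijection $\mathcal C\to\mathcal N_3$. The ruled quintic surface $\mathcal V$ is the set of points on the $q+1$ lines (generators) joining each point of $\mathcal C$ to its image under $\phi$; $\mathcal C$ is its conic directrix. A twisted cubic is a normal rational curve spanning a $3$-space. *)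

theory Defs
  imports "HOL-Analysis.Analysis"
begin

text \<open>Projective spaces over a field are modelled by linear subspaces: a projective \<open>k\<close>-space is a
  linear subspace of dimension \<open>k + 1\<close>, and a point is a projective \<open>0\<close>-space.\<close>

definition proj_space :: "nat \<Rightarrow> ('a::field ^ 'n) set \<Rightarrow> bool" where
  "proj_space k U \<longleftrightarrow> vec.subspace U \<and> vec.dim U = k + 1"

definition proj_points :: "('a::field ^ 'n) set \<Rightarrow> ('a ^ 'n) set set" where
  "proj_points U = {P. proj_space 0 P \<and> P \<subseteq> U}"

definition coord_frame :: "nat \<Rightarrow> ('a::field ^ 'n) set \<Rightarrow> (nat \<Rightarrow> 'a ^ 'n) \<Rightarrow> bool" where
  "coord_frame k U e \<longleftrightarrow>
     inj_on e {..k} \<and> vec.independent (e ` {..k}) \<and> vec.span (e ` {..k}) = U"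

text \<open>Parameters live in \<open>F\<^sub>q \<union> {\<infinity>}\<close>, modelled by \<open>'a option\<close> with \<open>None\<close> for \<open>\<infinity>\<close>.
  The point with parameter \<open>\<theta>\<close> has coordinates \<open>(1, \<theta>, \<dots>, \<theta>\<^sup>k)\<close> with respect to the frame \<open>e\<close>,
  and the point with parameter \<open>\<infinity>\<close> has coordinates \<open>(0, \<dots>, 0, 1)\<close>.\<close>

fun nrc_vector :: "nat \<Rightarrow> (nat \<Rightarrow> 'a::field ^ 'n) \<Rightarrow> 'a option \<Rightarrow> 'a ^ 'n" where
  "nrc_vector k e (Some \<theta>) = (\<Sum>i\<le>k. \<theta> ^ i *s e i)"
| "nrc_vector k e None = e k"

definition nrc_point :: "nat \<Rightarrow> (nat \<Rightarrow> 'a::field ^ 'n) \<Rightarrow> 'a option \<Rightarrow> ('a ^ 'n) set" where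
  "nrc_point k e \<theta> = vec.span {nrc_vector k e \<theta>}"

definition normal_rational_curve ::
    "nat \<Rightarrow> ('a::field ^ 'n) set \<Rightarrow> ('a ^ 'n) set set \<Rightarrow> bool" where
  "normal_rational_curve k U N \<longleftrightarrow>
     proj_space k U \<and> (\<exists>e. coord_frame k U e \<and> N = range (nrc_point k e))"

definition twisted_cubic :: "('a::field ^ 'n) set set \<Rightarrow> bool" where
  "twisted_cubic N \<longleftrightarrow> (\<exists>U. normal_rational_curve 3 U N)"

fun mobius :: "'a::field \<Rightarrow> 'a \<Rightarrow> 'a \<Rightarrow> 'a \<Rightarrow> 'a option \<Rightarrow> 'a option" where
  "mobius a b c d (Some \<theta>) =
     (if c * \<theta> + d = 0 then None else Some ((a * \<theta> + b) / (c * \<theta> + d)))"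
| "mobius a b c d None = (if c = 0 then None else Some (a / c))"

definition PGL2 :: "('a::field option \<Rightarrow> 'a option) set" where
  "PGL2 = {mobius a b c d | a b c d. a * d - b * c \<noteq> 0}"

text \<open>The frames \<open>e\<close> of the plane \<open>\<alpha>\<close> and \<open>f\<close> of the 3-space fix the parametrisations of the conic
  and of the twisted cubic.\<close>

definition generators ::
    "(nat \<Rightarrow> 'a::field ^ 'n) \<Rightarrow> (nat \<Rightarrow> 'a ^ 'n) \<Rightarrow> ('a option \<Rightarrow> 'a option) \<Rightarrow> ('a ^ 'n) set set" where
  "generators e f \<phi> =
     range (\<lambda>\<theta>. vec.span (nrc_point 2 e \<theta> \<union> nrc_point 3 f (\<phi> \<theta>)))"

definition ruled_quintic_surface ::
    "('a::field ^ 7) set \<Rightarrow> ('a ^ 7) set set \<Rightarrow> ('a ^ 7) set set \<Rightarrow> bool" where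
  "ruled_quintic_surface \<alpha> G V \<longleftrightarrow>
     proj_space 2 \<alpha> \<and>
     (\<exists>S e f \<phi>. proj_space 3 S \<and> proj_points \<alpha> \<inter> proj_points S = {} \<and>
        coord_frame 2 \<alpha> e \<and> coord_frame 3 S f \<and> \<phi> \<in> PGL2 \<and>
        G = generators e f \<phi> \<and> V = (\<Union>l\<in>G. proj_points l))"

end

theory Submission
  imports Defs "HOL-Computational_Algebra.Polynomial"
begin

text \<open>
  After a change of frame we may take \<open>\<phi> = id\<close>, so that the generators join \<open>c(\<theta>) = (1, \<theta>, \<theta>\<^sup>2)\<close> in
  \<open>\<alpha>\<close> to \<open>n(\<theta>) = (1, \<theta>, \<theta>\<^sup>2, \<theta>\<^sup>3)\<close> in \<open>S\<close>. Let \<open>N\<close> be a twisted cubic on the surface, spanning \<open>U\<close>,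
  and let \<open>d\<close> be the vector space dimension of \<open>U \<inter> \<alpha>\<close>. Projecting \<open>U\<close> from \<open>\<alpha>\<close> into \<open>S\<close> gives a subspace
  of dimension \<open>4 - d\<close>, so if \<open>d > 0\<close> then the points of \<open>N\<close> outside \<open>\<alpha>\<close> lie on at most \<open>4 - d\<close> generators.
  Since any four points of \<open>N\<close> are independent, \<open>N\<close> has at most two points on each generator and at most
  \<open>d\<close> points in \<open>\<alpha>\<close>, hence at most \<open>d + 2 (4 - d) \<le> 6\<close> points if \<open>d \<ge> 2\<close>. If \<open>d = 1\<close>, the subspaces
  \<open>U \<inter> \<langle>\<alpha>, n(\<theta>)\<rangle>\<close> have dimension at most 2, and at most three of them cover \<open>N\<close>, which again gives at
  most six points. As \<open>N\<close> has \<open>q + 1 > 6\<close> points, \<open>d = 0\<close>. Then \<open>U\<close> projects isomorphically onto \<open>S\<close> and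
  \<open>N\<close> consists of the points \<open>n(\<theta>) + l(\<theta>) c(\<theta>)\<close>. Comparing coordinates, which are polynomials of degree
  at most \<open>3 < q\<close>, shows that \<open>l(\<theta>) = a + b \<theta>\<close>. Conversely each of the \<open>q\<^sup>2\<close> choices of \<open>(a, b)\<close> yields
  a twisted cubic.
\<close>

section \<open>Polynomials and independent families\<close>

lemma coeff_mult_degree_le:
  fixes p q :: "'a::comm_semiring_0 poly"
  assumes "degree p \<le> m" "degree q \<le> n"
  shows "coeff (p * q) (m + n) = coeff p m * coeff q n"
proof -
  have "coeff (p * q) (m + n) = (\<Sum>i\<le>m + n. coeff p i * coeff q (m + n - i))"
    by (simp add: coeff_mult)
  also have "\<dots> = (\<Sum>i\<in>{m}. coeff p i * coeff q (m + n - i))"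
  proof (rule sum.mono_neutral_right)
    show "\<forall>i\<in>{..m + n} - {m}. coeff p i * coeff q (m + n - i) = 0"
    proof
      fix i
      assume "i \<in> {..m + n} - {m}"
      then have "i > m \<or> m + n - i > n"
        by auto
      then show "coeff p i * coeff q (m + n - i) = 0"
        using assms by (auto simp: coeff_eq_0)
    qed
  qed auto
  finally show ?thesis
    by simp
qed

text \<open>A nonzero polynomial has at most \<open>degree p\<close> roots. The bound on the degree
  is what turns equality of functions on a finite field into equality of coefficients.\<close>

lemma poly_eq_0_if_all_zero:
  fixes p :: "'a::{field,finite} poly"
  assumes "\<And>x. poly p x = 0" "degree p < CARD('a)"
  shows "p = 0"
proof (rule ccontr)
  assume "p \<noteq> 0"
  then have "card {x. poly p x = 0} \<le> degree p"
    by (rule card_poly_roots_bound)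
  with assms show False
    by simp
qed

lemma sum_atMost_2: "(\<Sum>i\<le>2. h i) = h 0 + h 1 + h (2::nat)"
  by (simp add: numeral_2_eq_2)

lemma sum_atMost_3: "(\<Sum>i\<le>3. h i) = h 0 + h 1 + h 2 + h (3::nat)"
  by (simp add: numeral_2_eq_2 numeral_3_eq_3)

text \<open>\<open>vec.independent\<close> speaks of a set, which hides repetitions; injectivity
  restores independence of the family.\<close>

lemma indexed_independent_iff:
  fixes v :: "'i \<Rightarrow> 'a::field ^ 'n"
  assumes I: "finite I"
  shows "inj_on v I \<and> vec.independent (v ` I) \<longleftrightarrow>
    (\<forall>g. (\<Sum>i\<in>I. g i *s v i) = 0 \<longrightarrow> (\<forall>i\<in>I. g i = 0))"
proof (intro iffI allI impI ballI)
  fix g i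
  assume v: "inj_on v I \<and> vec.independent (v ` I)" and g: "(\<Sum>i\<in>I. g i *s v i) = 0" and i: "i \<in> I"
  have "(\<Sum>w\<in>v ` I. g (inv_into I v w) *s w) = (\<Sum>i\<in>I. g i *s v i)"
    using v by (subst sum.reindex) (auto intro!: sum.cong)
  then have "g (inv_into I v (v i)) = 0"
    using vec.independentD[of "v ` I" "v ` I" "\<lambda>w. g (inv_into I v w)" "v i"] v I g i by auto
  then show "g i = 0"
    using v i by simp
next
  assume *: "\<forall>g. (\<Sum>i\<in>I. g i *s v i) = 0 \<longrightarrow> (\<forall>i\<in>I. g i = 0)"
  have inj: "inj_on v I"
  proof (rule inj_onI, rule ccontr)
    fix i j
    assume ij: "i \<in> I" "j \<in> I" "v i = v j" "i \<noteq> j"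
    let ?g = "(\<lambda>_. 0)(i := 1, j := -1) :: 'i \<Rightarrow> 'a"
    have "(\<Sum>k\<in>I. ?g k *s v k) = (\<Sum>k\<in>{i, j}. ?g k *s v k)"
      using I ij by (intro sum.mono_neutral_right) auto
    also have "\<dots> = 0"
      using ij by simp
    finally show False
      using * ij by (metis fun_upd_apply zero_neq_one)
  qed
  moreover have "vec.independent (v ` I)"
  proof (rule vec.independent_if_scalars_zero)
    fix u w
    assume u: "(\<Sum>w\<in>v ` I. u w *s w) = 0" and w: "w \<in> v ` I"
    have "(\<Sum>i\<in>I. u (v i) *s v i) = 0"
      using u inj by (simp add: sum.reindex)
    then show "u w = 0"
      using * w by auto
  qed (use I in simp)
  ultimately show "inj_on v I \<and> vec.independent (v ` I)" ..
qed

section \<open>Coordinate frames and disjoint subspaces\<close>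

lemma coord_frame_coords_zero:
  assumes "coord_frame k U e" "(\<Sum>i\<le>k. g i *s e i) = 0" "i \<le> k"
  shows "g i = 0"
proof -
  have "inj_on e {..k} \<and> vec.independent (e ` {..k})"
    using assms(1) unfolding coord_frame_def by blast
  then show ?thesis
    using assms(2,3) indexed_independent_iff[of "{..k}" e] by blast
qed

lemma coord_frame_subspace: "coord_frame k U e \<Longrightarrow> vec.subspace U"
  unfolding coord_frame_def by (metis vec.subspace_span)

lemma coord_frame_mem: "coord_frame k U e \<Longrightarrow> i \<le> k \<Longrightarrow> e i \<in> U"
  unfolding coord_frame_def by (metis atMost_iff image_eqI vec.span_base)

lemma coord_frame_dim: "coord_frame k U e \<Longrightarrow> vec.dim U = k + 1"
  unfolding coord_frame_def using vec.dim_span_eq_card_independent[of "e ` {..k}"]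
  by (auto simp: card_image)

lemma coord_frame_coords:
  assumes "coord_frame k U e" "u \<in> U"
  obtains g where "u = (\<Sum>i\<le>k. g i *s e i)"
proof -
  have "u \<in> range (\<lambda>g. \<Sum>v\<in>e ` {..k}. g v *s v)"
    using assms vec.span_finite[of "e ` {..k}"] unfolding coord_frame_def by auto
  then obtain h where "u = (\<Sum>v\<in>e ` {..k}. h v *s v)"
    by auto
  also have "\<dots> = (\<Sum>i\<le>k. h (e i) *s e i)"
    using assms unfolding coord_frame_def by (simp add: sum.reindex)
  finally show ?thesis
    using that[of "\<lambda>i. h (e i)"] by blast
qed

lemma coord_frameI:
  fixes e :: "nat \<Rightarrow> 'a::field ^ 'n"
  assumes "\<And>g i. (\<Sum>i\<le>k. g i *s e i) = 0 \<Longrightarrow> i \<le> k \<Longrightarrow> g i = 0"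
  shows "coord_frame k (vec.span (e ` {..k})) e"
proof -
  have "inj_on e {..k} \<and> vec.independent (e ` {..k})"
    unfolding indexed_independent_iff[OF finite_atMost] using assms by blast
  then show ?thesis
    unfolding coord_frame_def by blast
qed

lemma coord_frame_if_dim:
  fixes e :: "nat \<Rightarrow> 'a::field ^ 'n"
  assumes U: "vec.subspace U" "vec.dim U = k + 1" and e: "e ` {..k} \<subseteq> U" "U \<subseteq> vec.span (e ` {..k})"
  shows "coord_frame k U e"
proof -
  have span: "vec.span (e ` {..k}) = U"
    using U e vec.span_minimal by blast
  have "card (e ` {..k}) \<ge> k + 1"
    using vec.dim_le_card[OF e(2)] U by simp
  then have card: "card (e ` {..k}) = k + 1"
    using card_image_le[of "{..k}" e] by simp
  then have "inj_on e {..k}"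
    by (intro eq_card_imp_inj_on) auto
  moreover have "vec.independent (e ` {..k})"
    using vec.card_le_dim_spanning[OF e] U card by simp
  ultimately show ?thesis
    unfolding coord_frame_def using span by blast
qed

text \<open>A nonzero common vector spans a common point, so projective disjointness becomes a
  trivial intersection.\<close>

lemma proj_points_subspace_disjoint_iff:
  fixes A S :: "('a::field ^ 'n) set"
  assumes "vec.subspace A" "vec.subspace S"
  shows "proj_points A \<inter> proj_points S = {} \<longleftrightarrow> A \<inter> S = {0}"
proof
  assume disj: "proj_points A \<inter> proj_points S = {}"
  have "v = 0" if "v \<in> A" "v \<in> S" for v
  proof (rule ccontr)
    assume "v \<noteq> 0"
    then have "vec.span {v} \<in> proj_points A \<inter> proj_points S"
      using that assms unfolding proj_points_def proj_space_def by (simp add: vec.span_minimal)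
    with disj show False
      by blast
  qed
  then show "A \<inter> S = {0}"
    using assms vec.subspace_0 by blast
next
  assume "A \<inter> S = {0}"
  then have "P \<subseteq> {0}" if "P \<in> proj_points A \<inter> proj_points S" for P
    using that unfolding proj_points_def by blast
  moreover have "\<not> P \<subseteq> {0}" if "P \<in> proj_points A" for P
    using that vec.dim_eq_0[of P] unfolding proj_points_def proj_space_def by auto
  ultimately show "proj_points A \<inter> proj_points S = {}"
    by (metis IntD1 equals0I)
qed

section \<open>Points of a normal rational curve\<close>

lemma nrc_vector_eq_sum:
  "nrc_vector k e t =
    (\<Sum>i\<le>k. (case t of None \<Rightarrow> of_bool (i = k) | Some \<theta> \<Rightarrow> \<theta> ^ i) *s e i)"
  by (cases t) (auto simp: of_bool_def if_distrib[of "\<lambda>x. x *s _"] cong: if_cong)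

lemma nrc_vector_mem: "coord_frame k U e \<Longrightarrow> nrc_vector k e t \<in> U"
  unfolding nrc_vector_eq_sum
  by (intro vec.subspace_sum vec.subspace_scale) (simp_all add: coord_frame_subspace coord_frame_mem)

text \<open>A Vandermonde argument: applying to the relation the functional given by a polynomial
  that vanishes at all other parameters isolates one coefficient. The parameter \<open>None\<close>
  is treated last.\<close>

lemma nrc_vectors_lin_indep:
  fixes e :: "nat \<Rightarrow> 'a::field ^ 'n"
  assumes frame: "coord_frame k U e" and T: "finite T" "card T \<le> k + 1"
    and g: "(\<Sum>t\<in>T. g t *s nrc_vector k e t) = 0" and "t \<in> T"
  shows "g t = 0"
proof -
  let ?c = "\<lambda>i. case_option (of_bool (i = k)) (\<lambda>\<theta>. \<theta> ^ i) :: 'a option \<Rightarrow> 'a"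
  have coord: "(\<Sum>t\<in>T. g t * ?c i t) = 0" if "i \<le> k" for i
  proof -
    have "(\<Sum>i\<le>k. (\<Sum>t\<in>T. g t * ?c i t) *s e i) = (\<Sum>t\<in>T. g t *s nrc_vector k e t)"
      unfolding nrc_vector_eq_sum vec.scale_sum_left vec.scale_sum_right
      by (subst sum.swap) (simp add: vec.scale_scale)
    then have "(\<Sum>i\<le>k. (\<Sum>t\<in>T. g t * ?c i t) *s e i) = 0"
      using g by (rule trans)
    from coord_frame_coords_zero[OF frame this that] show ?thesis .
  qed
  \<comment> \<open>A polynomial of degree at most \<open>k\<close> is a linear form on the
    coordinates; its value at infinity is its coefficient of index \<open>k\<close>.\<close>
  have functional: "(\<Sum>t\<in>T. g t * (case t of None \<Rightarrow> coeff p k | Some \<theta> \<Rightarrow> poly p \<theta>)) = 0"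
    if "degree p \<le> k" for p
  proof -
    have eval: "(case t of None \<Rightarrow> coeff p k | Some \<theta> \<Rightarrow> poly p \<theta>) = (\<Sum>i\<le>k. coeff p i * ?c i t)" for t
      using that
      by (cases t) (auto simp: poly_altdef of_bool_def if_distrib[of "\<lambda>x. _ * x"]
          cong: if_cong intro!: sum.mono_neutral_left le_degree)
    have "(\<Sum>t\<in>T. g t * (case t of None \<Rightarrow> coeff p k | Some \<theta> \<Rightarrow> poly p \<theta>))
        = (\<Sum>i\<le>k. coeff p i * (\<Sum>t\<in>T. g t * ?c i t))"
      unfolding eval sum_distrib_left by (subst sum.swap) (simp only: mult.left_commute)
    also have "\<dots> = 0"
      using coord by simp
    finally show ?thesis .
  qed
  have finite_param: "g (Some \<theta>) = 0" if \<theta>: "Some \<theta> \<in> T" for \<theta>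
  proof -
    \<comment> \<open>The degree of \<open>p\<close> is below \<open>k\<close> if \<open>\<infinity> \<in> T\<close>, so \<open>p\<close> vanishes at \<open>\<infinity>\<close> as well.\<close>
    define R where "R = {\<eta>. Some \<eta> \<in> T - {Some \<theta>}}"
    define p where "p = (\<Prod>\<eta>\<in>R. [:-\<eta>, 1:])"
    have R: "Some ` R = T - {None, Some \<theta>}"
      unfolding R_def by (auto simp: image_iff)
    then have "finite R"
      using T by (metis finite_Diff finite_imageD inj_Some inj_on_subset subset_UNIV)
    have "degree p = card (Some ` R)"
      unfolding p_def by (simp add: degree_prod_sum_eq card_image)
    also have "\<dots> = card (T - {Some \<theta>} - {None})"
      unfolding R by (metis Diff_insert2 insert_commute)
    finally have deg: "degree p = card (T - {Some \<theta>} - {None})" .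
    have card: "card (T - {Some \<theta>}) \<le> k"
      using T \<theta> by simp
    then have "degree p \<le> k"
      using deg T by (metis card_Diff1_le le_trans)
    have "None \<in> T \<Longrightarrow> degree p < k"
      unfolding deg using card T
      by (metis DiffI card_Diff1_less empty_iff finite_Diff insertE option.distinct(1)
          order_less_le_trans)
    then have "(case t of None \<Rightarrow> coeff p k | Some \<theta> \<Rightarrow> poly p \<theta>) = 0" if "t \<in> T - {Some \<theta>}" for t
      using that \<open>finite R\<close> by (auto simp: coeff_eq_0 p_def poly_prod R_def split: option.split)
    then have "g (Some \<theta>) * poly p \<theta> = 0"
      using functional[OF \<open>degree p \<le> k\<close>] T \<theta> by (simp add: sum.remove)
    moreover have "poly p \<theta> \<noteq> 0"
      using \<open>finite R\<close> by (auto simp: p_def poly_prod R_def)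
    ultimately show ?thesis
      by simp
  qed
  show ?thesis
  proof (cases t)
    case None
    \<comment> \<open>All finite parameters already have coefficient 0, so the last coordinate
      contains only the term at infinity.\<close>
    have "(\<Sum>t\<in>T. g t * ?c k t) = (\<Sum>t\<in>{None}. g t * ?c k t)"
      using T \<open>t \<in> T\<close> None finite_param
      by (intro sum.mono_neutral_right) (auto split: option.split)
    then show ?thesis
      using coord[of k] None by simp
  next
    case (Some \<theta>)
    then show ?thesis
      using finite_param \<open>t \<in> T\<close> by blast
  qed
qed

lemma nrc_vectors_independent:
  assumes "coord_frame k U e" "finite T" "card T \<le> k + 1"
  shows "inj_on (nrc_vector k e) T" "vec.independent (nrc_vector k e ` T)"
proof -
  have "inj_on (nrc_vector k e) T \<and> vec.independent (nrc_vector k e ` T)"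
    unfolding indexed_independent_iff[OF assms(2)] using nrc_vectors_lin_indep[OF assms] by blast
  then show "inj_on (nrc_vector k e) T" "vec.independent (nrc_vector k e ` T)"
    by auto
qed

lemma nrc_vector_nonzero:
  assumes "coord_frame k U e"
  shows "nrc_vector k e t \<noteq> 0"
  using nrc_vectors_lin_indep[OF assms, of "{t}" "\<lambda>_. 1" t] by auto

lemma nrc_vector_scale_eq:
  assumes "coord_frame k U e" "k \<ge> 1" "y *s nrc_vector k e s = x *s nrc_vector k e t" "y \<noteq> 0"
  shows "s = t"
proof (rule ccontr)
  assume "s \<noteq> t"
  then have "(\<Sum>r\<in>{s, t}. (if r = s then y else - x) *s nrc_vector k e r) = 0"
    using assms(3) by simp
  then show False
    using nrc_vectors_lin_indep[OF assms(1), of "{s, t}" "\<lambda>r. if r = s then y else - x" s]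
      assms \<open>s \<noteq> t\<close> by auto
qed

text \<open>One parameter more would give \<open>vec.dim W + 1\<close> vectors in \<open>W\<close>,
  independent because their number is at most \<open>k + 1\<close>.\<close>

lemma card_nrc_params_le_dim:
  fixes e :: "nat \<Rightarrow> 'a::{field,finite} ^ 'n"
  assumes "coord_frame k U e" "vec.dim W \<le> k"
  shows "card {t. nrc_vector k e t \<in> W} \<le> vec.dim W"
proof (rule ccontr)
  assume "\<not> ?thesis"
  then obtain T where T: "T \<subseteq> {t. nrc_vector k e t \<in> W}" "card T = vec.dim W + 1"
    by (metis Suc_eq_plus1 not_less_eq_eq obtain_subset_with_card_n)
  have "finite T"
    by simp
  note indep = nrc_vectors_independent[OF assms(1) this]
  have "card (nrc_vector k e ` T) \<le> vec.dim W"
    using T assms indep by (intro vec.independent_card_le_dim) auto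
  then show False
    using T assms indep by (simp add: card_image)
qed

text \<open>The curve has at least \<open>k + 1\<close> points, and any \<open>k + 1\<close> of them
  form a basis of \<open>U\<close>.\<close>

lemma nrc_subspace_subset:
  fixes e :: "nat \<Rightarrow> 'a::{field,finite} ^ 'n"
  assumes "coord_frame k U e" "CARD('a) \<ge> k" "vec.subspace W" "\<And>t. nrc_vector k e t \<in> W"
  shows "U \<subseteq> W"
proof -
  obtain T :: "'a option set" where T: "card T = k + 1"
    using assms(2) obtain_subset_with_card_n[of "k + 1" "UNIV :: 'a option set"] by auto
  have "finite T"
    by simp
  note indep = nrc_vectors_independent[OF assms(1) this]
  have "U \<subseteq> vec.span (nrc_vector k e ` T)"
    using T indep coord_frame_dim[OF assms(1)] nrc_vector_mem[OF assms(1)]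
    by (intro vec.card_ge_dim_independent) (auto simp: card_image)
  also have "\<dots> \<subseteq> W"
    using assms by (intro vec.span_minimal) auto
  finally show ?thesis .
qed

lemma nrc_point_in_proj_points_iff:
  assumes "coord_frame k U g" "vec.subspace W"
  shows "nrc_point k g t \<in> proj_points W \<longleftrightarrow> nrc_vector k g t \<in> W"
proof -
  have "vec.span {v} \<subseteq> W \<longleftrightarrow> v \<in> W" for v
    using vec.span_minimal[of "{v}" W] assms(2) vec.span_base[of v "{v}"] by auto
  then show ?thesis
    using nrc_vector_nonzero[OF assms(1), of t]
    unfolding nrc_point_def proj_points_def proj_space_def by simp
qed

section \<open>Reparametrisation by the projective linear group\<close>

lemma mobius_inj:
  fixes a b c d :: "'a::field"
  assumes "a * d - b * c \<noteq> 0"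
  shows "inj (mobius a b c d)"
proof (rule injI)
  fix s t
  assume eq: "mobius a b c d s = mobius a b c d t"
  show "s = t"
  proof (cases s; cases t)
    fix x y
    assume st: "s = Some x" "t = Some y"
    have "(a * x + b) * (c * y + d) = (a * y + b) * (c * x + d)"
      using eq st by (auto simp: frac_eq_eq split: if_splits)
    then have "(a * d - b * c) * (x - y) = 0"
      by (simp add: algebra_simps)
    with assms st show ?thesis
      by simp
  next
    fix x
    assume st: "s = Some x" "t = None"
    then have "(a * x + b) * c = a * (c * x + d)"
      using eq by (auto simp: field_simps split: if_splits)
    then have "a * d - b * c = 0"
      by (simp add: algebra_simps)
    with assms show ?thesis
      by simp
  next
    fix y
    assume st: "s = None" "t = Some y"
    then have "(a * y + b) * c = a * (c * y + d)"
      using eq by (auto simp: field_simps split: if_splits)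
    then have "a * d - b * c = 0"
      by (simp add: algebra_simps)
    with assms show ?thesis
      by simp
  qed simp
qed

lemma span_singleton_scale:
  fixes v :: "'a::field ^ 'n"
  assumes "x \<noteq> 0"
  shows "vec.span {x *s v} = vec.span {v}"
  using vec.span_image_scale[of "{v}" "\<lambda>_. x"] assms by simp

text \<open>A Moebius change of parameter acts on the coordinates \<open>(1, \<theta>, \<dots>, \<theta>\<^sup>k)\<close>, up to the factor
  \<open>(c \<theta> + d)\<^sup>k\<close>, by the linear map with \<open>j\<close>-th component \<open>(a \<theta> + b)\<^sup>j (c \<theta> + d)\<^sup>k\<^sup>-\<^sup>j\<close>.\<close>

lemma nrc_reparam:
  fixes f :: "nat \<Rightarrow> 'a::{field,finite} ^ 'n"
  assumes frame: "coord_frame k S f" and q: "CARD('a) \<ge> k" and \<phi>: "\<phi> \<in> PGL2"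
  obtains f' where "coord_frame k S f'" "\<And>t. nrc_point k f' t = nrc_point k f (\<phi> t)"
proof -
  obtain a b c d where \<phi>_eq: "\<phi> = mobius a b c d" and det: "a * d - b * c \<noteq> 0"
    using \<phi> unfolding PGL2_def by blast
  define p where "p = (\<lambda>j. [:b, a:] ^ j * [:d, c:] ^ (k - j))"
  define f' where "f' = (\<lambda>i. \<Sum>j\<le>k. coeff (p j) i *s f j)"
  have lin_degree: "degree ([:x, y:] ^ n) \<le> n" for x y :: 'a and n
    by (rule order_trans[OF degree_power_le]) (simp add: degree_pCons_le)
  have deg: "degree (p j) \<le> k" if "j \<le> k" for j
    using degree_mult_le[of "[:b, a:] ^ j" "[:d, c:] ^ (k - j)"] lin_degree[of b a j]
      lin_degree[of d c "k - j"] that unfolding p_def by linarith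
  have lin_coeff: "coeff ([:x, y:] ^ n) n = y ^ n" for x y :: 'a and n
    by (induction n) (auto simp: coeff_eq_0 lin_degree le_imp_less_Suc)
  \<comment> \<open>The coefficient of index \<open>k\<close> gives the image of infinity, with
    homogeneous parameter \<open>(a, c)\<close>; it may vanish, so it need not be a leading
    coefficient.\<close>
  have top: "coeff (p j) k = a ^ j * c ^ (k - j)" if "j \<le> k" for j
  proof -
    have "coeff (p j) k = coeff ([:b, a:] ^ j * [:d, c:] ^ (k - j)) (j + (k - j))"
      using that by (simp add: p_def)
    also have "\<dots> = coeff ([:b, a:] ^ j) j * coeff ([:d, c:] ^ (k - j)) (k - j)"
      by (rule coeff_mult_degree_le) (rule lin_degree)+
    finally show ?thesis
      by (simp add: lin_coeff)
  qed
  have "nrc_vector k f' (Some \<theta>) = (\<Sum>j\<le>k. ((a * \<theta> + b) ^ j * (c * \<theta> + d) ^ (k - j)) *s f j)" for \<theta>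
  proof -
    have "nrc_vector k f' (Some \<theta>) = (\<Sum>j\<le>k. (\<Sum>i\<le>k. coeff (p j) i * \<theta> ^ i) *s f j)"
      unfolding f'_def nrc_vector.simps vec.scale_sum_left vec.scale_sum_right
      by (subst sum.swap) (simp add: vec.scale_scale mult.commute)
    also have "\<dots> = (\<Sum>j\<le>k. poly (p j) \<theta> *s f j)"
    proof (rule sum.cong[OF refl])
      fix j
      assume "j \<in> {..k}"
      then have "(\<Sum>i\<le>k. coeff (p j) i * \<theta> ^ i) = poly (p j) \<theta>"
        unfolding poly_altdef using deg[of j] by (intro sum.mono_neutral_right) (auto simp: coeff_eq_0)
      then show "(\<Sum>i\<le>k. coeff (p j) i * \<theta> ^ i) *s f j = poly (p j) \<theta> *s f j"
        by simp
    qed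
    also have "\<dots> = (\<Sum>j\<le>k. ((a * \<theta> + b) ^ j * (c * \<theta> + d) ^ (k - j)) *s f j)"
      by (simp add: p_def poly_power algebra_simps)
    finally show ?thesis .
  qed
  moreover have "nrc_vector k f' None = (\<Sum>j\<le>k. (a ^ j * c ^ (k - j)) *s f j)"
    unfolding f'_def nrc_vector.simps by (intro sum.cong) (simp_all add: top)
  \<comment> \<open>Here \<open>(x, y)\<close> is a homogeneous parameter; normalising it costs the
    factor \<open>x ^ k\<close> or \<open>y ^ k\<close>.\<close>
  moreover have homogeneous: "\<exists>w. w \<noteq> 0 \<and> (\<Sum>j\<le>k. (x ^ j * y ^ (k - j)) *s f j) =
      w *s nrc_vector k f (if y = 0 then None else Some (x / y))" if "x \<noteq> 0 \<or> y \<noteq> 0" for x y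
  proof (cases "y = 0")
    case True
    have "(\<Sum>j\<le>k. (x ^ j * y ^ (k - j)) *s f j) = (\<Sum>j\<in>{k}. (x ^ j * y ^ (k - j)) *s f j)"
      using True by (intro sum.mono_neutral_right) auto
    then show ?thesis
      using that True by (intro exI[of _ "x ^ k"]) simp
  next
    case False
    have "(\<Sum>j\<le>k. (x ^ j * y ^ (k - j)) *s f j) = y ^ k *s nrc_vector k f (Some (x / y))"
      unfolding nrc_vector.simps vec.scale_sum_right
    proof (rule sum.cong[OF refl])
      fix j
      assume "j \<in> {..k}"
      then have "y ^ k = y ^ j * y ^ (k - j)"
        by (simp flip: power_add)
      then show "(x ^ j * y ^ (k - j)) *s f j = y ^ k *s ((x / y) ^ j *s f j)"
        using False by (simp add: vec.scale_scale power_divide)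
    qed
    then show ?thesis
      using False by (intro exI[of _ "y ^ k"]) simp
  qed
  moreover have "a * \<theta> + b \<noteq> 0 \<or> c * \<theta> + d \<noteq> 0" for \<theta>
  proof (rule ccontr)
    assume "\<not> ?thesis"
    then have "d = - (c * \<theta>)" "b = - (a * \<theta>)"
      by (simp_all add: eq_neg_iff_add_eq_0 add.commute)
    with det show False
      by simp
  qed
  moreover have "a \<noteq> 0 \<or> c \<noteq> 0"
    using det by auto
  ultimately have scale: "\<exists>w. w \<noteq> 0 \<and> nrc_vector k f' t = w *s nrc_vector k f (\<phi> t)" for t
    by (cases t) (simp_all add: \<phi>_eq)
  then have points: "nrc_point k f' t = nrc_point k f (\<phi> t)" for t
    unfolding nrc_point_def by (metis span_singleton_scale)
  have "f' i \<in> S" for i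
    unfolding f'_def using coord_frame_subspace[OF frame] coord_frame_mem[OF frame]
    by (intro vec.subspace_sum vec.subspace_scale) auto
  \<comment> \<open>Every point of the old curve is a point of the new one, since
    \<open>\<phi>\<close> is surjective, and the old curve spans \<open>S\<close>.\<close>
  moreover have "S \<subseteq> vec.span (f' ` {..k})"
  proof (rule nrc_subspace_subset[OF frame q vec.subspace_span])
    fix s
    have "surj \<phi>"
      unfolding \<phi>_eq using mobius_inj[OF det] by (simp add: finite_UNIV_inj_surj)
    then obtain t where t: "s = \<phi> t"
      by auto
    have "nrc_vector k f s \<in> nrc_point k f s"
      unfolding nrc_point_def by (simp add: vec.span_base)
    then have "nrc_vector k f s \<in> nrc_point k f' t"
      using points t by simp
    moreover have "nrc_vector k f' t \<in> vec.span (f' ` {..k})"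
      unfolding nrc_vector_eq_sum by (intro vec.span_sum vec.span_scale vec.span_base) auto
    ultimately show "nrc_vector k f s \<in> vec.span (f' ` {..k})"
      unfolding nrc_point_def using vec.span_minimal[OF _ vec.subspace_span] by blast
  qed
  ultimately have "coord_frame k S f'"
    using coord_frame_subspace[OF frame] coord_frame_dim[OF frame] by (intro coord_frame_if_dim) auto
  with points that show ?thesis
    by blast
qed

section \<open>The surface with normalised parameters\<close>

text \<open>The parameter map is assumed to be absorbed into \<open>f\<close>, so that equal
  parameters on the conic and the cubic correspond.\<close>

locale conic_cubic_frames =
  fixes A S :: "('a::{field,finite} ^ 'n) set" and e f :: "nat \<Rightarrow> 'a ^ 'n"
  assumes e: "coord_frame 2 A e" and f: "coord_frame 3 S f" and disjoint: "A \<inter> S = {0}"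
begin

abbreviation "c \<equiv> nrc_vector 2 e"
abbreviation "n \<equiv> nrc_vector 3 f"

definition gen :: "'a option \<Rightarrow> ('a ^ 'n) set" where
  "gen t = vec.span {c t, n t}"

lemmas A = coord_frame_subspace[OF e] and S = coord_frame_subspace[OF f]
lemmas dim_A = coord_frame_dim[OF e] and dim_S = coord_frame_dim[OF f]
lemmas c_mem = nrc_vector_mem[OF e] and n_mem = nrc_vector_mem[OF f]

lemma mem_gen_iff: "v \<in> gen t \<longleftrightarrow> (\<exists>x y. v = x *s c t + y *s n t)"
proof -
  have "v \<in> gen t \<longleftrightarrow> (\<exists>x y. v - x *s c t = y *s n t)"
    unfolding gen_def vec.span_insert vec.span_singleton by auto
  then show ?thesis
    by (simp add: diff_eq_eq add.commute)
qed

lemma subspace_gen: "vec.subspace (gen t)"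
  unfolding gen_def by simp

lemma dim_gen_le: "vec.dim (gen t) \<le> 2"
  using vec.dim_le_card[of "gen t" "{c t, n t}"] unfolding gen_def
  by (auto simp: card_insert_if split: if_splits)

lemma decomposition_unique:
  assumes "a + s = a' + s'" "a \<in> A" "a' \<in> A" "s \<in> S" "s' \<in> S"
  shows "a = a' \<and> s = s'"
proof -
  have "a - a' = s' - s"
    using assms(1) by (simp add: algebra_simps)
  moreover have "a - a' \<in> A" "s' - s \<in> S"
    using assms A S vec.subspace_diff by blast+
  ultimately have "a - a' \<in> A \<inter> S"
    by simp
  with \<open>a - a' = s' - s\<close> show ?thesis
    unfolding disjoint by simp
qed

subsection \<open>Directrix cubics\<close>

text \<open>At infinity the value is the coefficient of \<open>\<theta>\<close>, to match the
  coefficient of \<open>\<theta> ^ 3\<close> in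
  \<open>n(\<theta>) + (a + b \<theta>) c(\<theta>)\<close>.\<close>

definition lin :: "'a \<Rightarrow> 'a \<Rightarrow> 'a option \<Rightarrow> 'a" where
  "lin a b t = (case t of None \<Rightarrow> b | Some \<theta> \<Rightarrow> a + b * \<theta>)"

text \<open>Frame of the cubic \<open>{n(\<theta>) + (a + b \<theta>) c(\<theta>)}\<close>, read off by comparing powers of \<open>\<theta>\<close>.\<close>

definition directrix_frame :: "'a \<Rightarrow> 'a \<Rightarrow> nat \<Rightarrow> 'a ^ 'n" where
  "directrix_frame a b i =
     f i + ((if i \<le> 2 then a *s e i else 0) + (if i = 0 then 0 else b *s e (i - 1)))"

abbreviation "directrix a b \<equiv> range (nrc_point 3 (directrix_frame a b))"

lemma nrc_vector_directrix_frame: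
  "nrc_vector 3 (directrix_frame a b) t = n t + lin a b t *s c t"
  by (cases t)
    (simp_all add: sum_atMost_2 sum_atMost_3 directrix_frame_def lin_def vec_eq_iff algebra_simps
      power2_eq_square power3_eq_cube)

text \<open>The new frame differs from \<open>f\<close> by vectors of \<open>A\<close>; projecting a
  relation along \<open>A\<close> to \<open>S\<close> gives a relation among the
  \<open>f i\<close>.\<close>

lemma coord_frame_directrix:
  "coord_frame 3 (vec.span (directrix_frame a b ` {..3})) (directrix_frame a b)"
proof (rule coord_frameI)
  fix g :: "nat \<Rightarrow> 'a" and i :: nat
  assume sum: "(\<Sum>i\<le>3. g i *s directrix_frame a b i) = 0" and i: "i \<le> 3"
  define h where "h i = directrix_frame a b i - f i" for i
  have h: "h i \<in> A" if "i \<le> 3" for i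
    using that unfolding h_def directrix_frame_def
    by (auto intro!: vec.subspace_add[OF A] vec.subspace_scale[OF A] vec.subspace_0[OF A]
        coord_frame_mem[OF e])
  have "(\<Sum>i\<le>3. g i *s h i) + (\<Sum>i\<le>3. g i *s f i) = (\<Sum>i\<le>3. g i *s directrix_frame a b i)"
    by (simp add: h_def vec.scale_right_diff_distrib flip: sum.distrib)
  then have sum_0: "(\<Sum>i\<le>3. g i *s h i) + (\<Sum>i\<le>3. g i *s f i) = 0 + 0"
    using sum by simp
  have "(\<Sum>i\<le>3. g i *s h i) \<in> A"
    using h by (intro vec.subspace_sum[OF A] vec.subspace_scale[OF A]) simp
  moreover have "(\<Sum>i\<le>3. g i *s f i) \<in> S"
    using coord_frame_mem[OF f] by (intro vec.subspace_sum[OF S] vec.subspace_scale[OF S]) simp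
  ultimately have "(\<Sum>i\<le>3. g i *s f i) = 0"
    using decomposition_unique[OF sum_0] vec.subspace_0[OF A] vec.subspace_0[OF S] by simp
  from coord_frame_coords_zero[OF f this i] show "g i = 0" .
qed

lemma directrix_frame_mem_gen_iff: "nrc_vector 3 (directrix_frame a b) s \<in> gen t \<longleftrightarrow> s = t"
proof
  assume "nrc_vector 3 (directrix_frame a b) s \<in> gen t"
  then obtain x y where "lin a b s *s c s + n s = x *s c t + y *s n t"
    unfolding mem_gen_iff nrc_vector_directrix_frame by (auto simp: add.commute)
  from decomposition_unique[OF this vec.subspace_scale[OF A c_mem] vec.subspace_scale[OF A c_mem]
      n_mem vec.subspace_scale[OF S n_mem]]
  have "n s = y *s n t" ..
  then show "s = t"
    using nrc_vector_scale_eq[OF f, of 1 s y t] by simp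
next
  assume "s = t"
  then show "nrc_vector 3 (directrix_frame a b) s \<in> gen t"
    unfolding mem_gen_iff nrc_vector_directrix_frame
    by (intro exI[of _ "lin a b t"] exI[of _ 1]) (simp add: add.commute)
qed

lemma directrix_point_on_gen_iff:
  "P \<in> directrix a b \<and> P \<in> proj_points (gen t) \<longleftrightarrow> P = nrc_point 3 (directrix_frame a b) t"
  by (auto simp: nrc_point_in_proj_points_iff[OF coord_frame_directrix subspace_gen]
      directrix_frame_mem_gen_iff)

text \<open>Each generator meets both curves in a single point. If these agree, their spanning
  vectors are proportional, and the component in \<open>S\<close> forces the factor 1.\<close>

lemma lin_eq_if_directrix_eq:
  assumes "directrix a b = directrix a' b'"
  shows "lin a b t = lin a' b' t"
proof -
  have "nrc_point 3 (directrix_frame a b) t = nrc_point 3 (directrix_frame a' b') t"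
    using directrix_point_on_gen_iff[of "nrc_point 3 (directrix_frame a b) t" a b t]
      directrix_point_on_gen_iff[of "nrc_point 3 (directrix_frame a b) t" a' b' t] assms by simp
  then have "n t + lin a b t *s c t \<in> vec.span {n t + lin a' b' t *s c t}"
    unfolding nrc_point_def nrc_vector_directrix_frame by (metis singletonI vec.span_base)
  then obtain x where "n t + lin a b t *s c t = x *s (n t + lin a' b' t *s c t)"
    by (auto simp: vec.span_singleton)
  then have "lin a b t *s c t + n t = (x * lin a' b' t) *s c t + x *s n t"
    by (simp add: vec.scale_right_distrib add.commute)
  from decomposition_unique[OF this vec.subspace_scale[OF A c_mem] vec.subspace_scale[OF A c_mem]
      n_mem vec.subspace_scale[OF S n_mem]]
  have "lin a b t *s c t = (x * lin a' b' t) *s c t" "1 *s n t = x *s n t"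
    by simp_all
  moreover have "c t \<noteq> 0" "n t \<noteq> 0"
    using nrc_vector_nonzero e f by blast+
  ultimately have "lin a b t = x * lin a' b' t" "1 = x"
    by (simp_all only: vec.scale_cancel_right simp_thms)
  then show ?thesis
    by simp
qed

lemma inj_directrix: "inj (\<lambda>(a, b). directrix a b)"
proof (rule injI)
  fix p p' :: "'a \<times> 'a"
  assume "(\<lambda>(a, b). directrix a b) p = (\<lambda>(a, b). directrix a b) p'"
  then have "directrix (fst p) (snd p) = directrix (fst p') (snd p')"
    by (simp only: case_prod_beta)
  \<comment> \<open>The parameters 0 and infinity recover \<open>a\<close> and
    \<open>b\<close>.\<close>
  from lin_eq_if_directrix_eq[OF this, of "Some 0"] lin_eq_if_directrix_eq[OF this, of None]
  show "p = p'"
    by (simp add: lin_def prod_eq_iff)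
qed

subsection \<open>Cubics contained in the surface\<close>

lemma disjoint_if_cubic_on_surface:
  assumes g: "coord_frame 3 U g" and q: "CARD('a) \<ge> 6"
    and on: "\<And>t. \<exists>s. nrc_vector 3 g t \<in> gen s"
  shows "U \<inter> A = {0}"
proof -
  note U = coord_frame_subspace[OF g] and dim_U = coord_frame_dim[OF g]
  let ?m = "nrc_vector 3 g"
  define D where "D = U \<inter> A"
  define d where "d = vec.dim D"
  \<comment> \<open>\<open>W\<close> is the projection of \<open>U\<close> from \<open>A\<close> to
    \<open>S\<close>; \<open>K\<close> collects the generators that can carry points of the cubic
    outside \<open>A\<close>.\<close>
  define B where "B = {x + y | x y. x \<in> U \<and> y \<in> A}"
  define W where "W = B \<inter> S"
  define K where "K = {s. n s \<in> W}"
  have B: "vec.subspace B"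
    unfolding B_def using vec.subspace_sums[OF U A] .
  have "vec.dim B + d = 7"
    unfolding B_def d_def D_def using vec.dim_sums_Int[OF U A] dim_U dim_A by simp
  moreover have "vec.dim {x + y | x y. x \<in> B \<and> y \<in> S} + vec.dim W = vec.dim B + 4"
    unfolding W_def using vec.dim_sums_Int[OF B S] dim_S by simp
  moreover have "vec.dim {x + y | x y. x \<in> A \<and> y \<in> S} = 7"
    using vec.dim_sums_Int[OF A S] dim_A dim_S disjoint by simp
  moreover have "A \<subseteq> B"
    unfolding B_def using vec.subspace_0[OF U] by force
  then have "vec.dim {x + y | x y. x \<in> A \<and> y \<in> S} \<le> vec.dim {x + y | x y. x \<in> B \<and> y \<in> S}"
    by (intro vec.dim_subset) auto
  \<comment> \<open>\<open>B\<close> has dimension \<open>7 - d\<close> and \<open>B + S\<close> has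
    dimension at least 7, which leaves at most \<open>(7 - d) + 4 - 7\<close> for the
    intersection.\<close>
  ultimately have dim_W: "vec.dim W + d \<le> 4"
    by linarith
  have d_le: "d \<le> 3"
    unfolding d_def D_def using vec.dim_subset[of "U \<inter> A" A] dim_A by simp
  have cover: "?m t \<in> D \<or> (\<exists>s\<in>K. ?m t \<in> gen s)" for t
  proof -
    obtain s x y where s: "?m t \<in> gen s" and xy: "?m t = x *s c s + y *s n s"
      using on mem_gen_iff by metis
    show ?thesis
    proof (cases "y = 0")
      case True
      then have "?m t \<in> D"
        unfolding D_def using nrc_vector_mem[OF g, of t] vec.subspace_scale[OF A c_mem, of x s] xy by simp
      then show ?thesis ..
    next
      case False
      then have "n s = (1 / y) *s ?m t + (- x / y) *s c s"
        unfolding xy by (simp add: vec_eq_iff field_simps)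
      then have "n s \<in> B"
        unfolding B_def using vec.subspace_scale[OF U nrc_vector_mem[OF g]] vec.subspace_scale[OF A c_mem]
        by blast
      then have "s \<in> K"
        unfolding K_def W_def using n_mem by simp
      with s show ?thesis
        by blast
    qed
  qed
  have card_D: "card {t. ?m t \<in> D} \<le> d"
    unfolding d_def using card_nrc_params_le_dim[OF g, of D] d_le d_def by simp
  have card_union: "card (\<Union>s\<in>K. {t. ?m t \<in> X s}) \<le> card K * 2" if "\<And>s. vec.dim (X s) \<le> 2" for X
  proof -
    have "card {t. ?m t \<in> X s} \<le> 2" for s
      using card_nrc_params_le_dim[OF g, of "X s"] that[of s] by simp
    then have "(\<Sum>s\<in>K. card {t. ?m t \<in> X s}) \<le> card K * 2"
      using sum_bounded_above[of K "\<lambda>s. card {t. ?m t \<in> X s}" 2] by simp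
    then show ?thesis
      using card_UN_le[of K "\<lambda>s. {t. ?m t \<in> X s}"] by simp
  qed
  have "d = 0"
  proof (rule ccontr)
    assume "d \<noteq> 0"
    \<comment> \<open>Only for \<open>d > 0\<close> is \<open>vec.dim W\<close> at most 3, as the
      count of points on the cubic in \<open>S\<close> requires.\<close>
    then have card_K: "card K \<le> 4 - d"
      unfolding K_def using card_nrc_params_le_dim[OF f, of W] dim_W by simp
    show False
    proof (cases "d = 1")
      case True
      \<comment> \<open>\<open>X s\<close> contains both \<open>D\<close> and the curve points on
        \<open>gen s\<close>. It meets \<open>A\<close> in dimension 1, and its sum with
        \<open>A\<close> has dimension at most 4, so its own dimension is at most
        \<open>4 + 1 - 3\<close>.\<close>
      define X where "X s = U \<inter> {x + y | x y. x \<in> A \<and> y \<in> vec.span {n s}}" for s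
      have sub: "vec.subspace {x + y | x y. x \<in> A \<and> y \<in> vec.span {n s}}" for s
        by (intro vec.subspace_sums A vec.subspace_span)
      have A_sub: "A \<subseteq> {x + y | x y. x \<in> A \<and> y \<in> vec.span {n s}}" for s
        using vec.span_zero by force
      have dim_X: "vec.dim (X s) \<le> 2" for s
      proof -
        have "X s \<inter> A = D"
          unfolding X_def D_def using A_sub by blast
        moreover have "vec.subspace (X s)"
          unfolding X_def using U sub by (rule vec.subspace_inter)
        ultimately have "vec.dim {x + y | x y. x \<in> X s \<and> y \<in> A} + 1 = vec.dim (X s) + 3"
          using vec.dim_sums_Int[OF _ A, of "X s"] dim_A True d_def by simp
        moreover have "{x + y | x y. x \<in> X s \<and> y \<in> A} \<subseteq> {x + y | x y. x \<in> A \<and> y \<in> vec.span {n s}}"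
          using A_sub vec.subspace_add[OF sub] unfolding X_def by blast
        then have "vec.dim {x + y | x y. x \<in> X s \<and> y \<in> A} \<le> vec.dim {x + y | x y. x \<in> A \<and> y \<in> vec.span {n s}}"
          by (rule vec.dim_subset)
        moreover have "vec.dim {x + y | x y. x \<in> A \<and> y \<in> vec.span {n s}} \<le> 4"
        proof -
          have "vec.dim (vec.span {n s}) \<le> 1"
            by simp
          then show ?thesis
            using vec.dim_sums_Int[OF A vec.subspace_span[of "{n s}"]] dim_A by linarith
        qed
        ultimately show ?thesis
          by linarith
      qed
      \<comment> \<open>Some generator is needed in \<open>K\<close>, so that its \<open>X r\<close>
        can absorb the points in \<open>D\<close>.\<close>
      have "\<exists>t. ?m t \<notin> D"
      proof (rule ccontr)
        assume "\<not> ?thesis"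
        then have "{t. ?m t \<in> D} = UNIV"
          by auto
        with card_D True q show False
          by simp
      qed
      then obtain r where r: "r \<in> K"
        using cover by blast
      have gen_X: "?m t \<in> X s" if mem: "?m t \<in> gen s" for t s
      proof -
        obtain x y where "?m t = x *s c s + y *s n s"
          using mem mem_gen_iff by metis
        moreover have "y *s n s \<in> vec.span {n s}"
          by (intro vec.span_scale vec.span_base) simp
        moreover have "x *s c s \<in> A"
          using A c_mem by (rule vec.subspace_scale)
        moreover have "?m t \<in> U"
          using g by (rule nrc_vector_mem)
        ultimately show ?thesis
          unfolding X_def by auto
      qed
      have D_X: "D \<subseteq> X r"
        unfolding D_def X_def using A_sub by blast
      have "\<exists>s\<in>K. ?m t \<in> X s" for t
        using cover[of t] gen_X D_X r by blast
      \<comment> \<open>At most three sets with two parameters each would have to cover all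
        \<open>q + 1 > 6\<close> parameters.\<close>
      then have "(\<Union>s\<in>K. {t. ?m t \<in> X s}) = UNIV"
        by blast
      with card_union[of X, OF dim_X] card_K True q show False
        by simp
    next
      case False
      have "{t. ?m t \<in> D} \<union> (\<Union>s\<in>K. {t. ?m t \<in> gen s}) = UNIV"
        using cover by blast
      then have "CARD('a option) \<le> card {t. ?m t \<in> D} + card (\<Union>s\<in>K. {t. ?m t \<in> gen s})"
        by (metis card_Un_le)
      also have "\<dots> \<le> d + (4 - d) * 2"
        \<comment> \<open>For \<open>d \<ge> 2\<close> the bound equals \<open>8 - d\<close>, hence
          is at most 6.\<close>
        using card_D card_union[of gen, OF dim_gen_le] card_K by (meson add_mono mult_le_mono1 le_trans)
      finally show False
        using False \<open>d \<noteq> 0\<close> d_le q by simp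
    qed
  qed
  then show ?thesis
    unfolding d_def D_def using vec.subspace_0[OF U] vec.subspace_0[OF A] by auto
qed

text \<open>\<open>U\<close> meets \<open>A + S\<close> in the graph of a linear map from
  \<open>S\<close> to \<open>A\<close>. This map sends \<open>n t\<close> to
  \<open>l t *s c t\<close>, so \<open>l\<close>, \<open>\<theta> l\<close> and
  \<open>\<theta>\<^sup>2 l\<close> are all polynomials of degree at most 3 in
  \<open>\<theta>\<close>.\<close>

lemma lin_if_on_disjoint_subspace:
  assumes U: "vec.subspace U" "U \<inter> A = {0}" and q: "CARD('a) \<ge> 4"
    and mem: "\<And>t. n t + l t *s c t \<in> U"
  obtains a b where "l = lin a b"
proof -
  let ?B = "{x + y | x y. x \<in> U \<and> y \<in> A}"
  have "n t \<in> ?B" for t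
  proof -
    have "n t = (n t + l t *s c t) + (- l t) *s c t"
      by simp
    then show ?thesis
      using mem vec.subspace_scale[OF A c_mem] by blast
  qed
  then have "S \<subseteq> ?B"
    using q by (intro nrc_subspace_subset[OF f] vec.subspace_sums U A) auto
  have "\<exists>M. f i + (\<Sum>j\<le>2. M j *s e j) \<in> U" if "i \<le> 3" for i
  proof -
    have "f i \<in> ?B"
      using \<open>S \<subseteq> ?B\<close> coord_frame_mem[OF f that] by (rule subsetD)
    then obtain u v where uv: "f i = u + v" "u \<in> U" "v \<in> A"
      by auto
    obtain M where "- v = (\<Sum>j\<le>2. M j *s e j)"
      using coord_frame_coords[OF e vec.subspace_neg[OF A uv(3)]] by blast
    moreover have "f i + - v \<in> U"
      using uv by simp
    ultimately show ?thesis
      by metis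
  qed
  then obtain M where M: "\<And>i. i \<le> 3 \<Longrightarrow> f i + (\<Sum>j\<le>2. M i j *s e j) \<in> U"
    by metis
  define v where "v i = (\<Sum>j\<le>2. M i j *s e j)" for i
  \<comment> \<open>Both sides, added to \<open>n t\<close>, give vectors of \<open>U\<close>, so
    their difference lies in \<open>U \<inter> A\<close>.\<close>
  have eq: "nrc_vector 3 v t = l t *s c t" for t
  proof -
    have "nrc_vector 3 (\<lambda>i. f i + v i) t = n t + nrc_vector 3 v t"
      unfolding nrc_vector_eq_sum by (simp add: vec.scale_right_distrib sum.distrib)
    moreover have "nrc_vector 3 (\<lambda>i. f i + v i) t \<in> U"
      unfolding nrc_vector_eq_sum using M v_def
      by (intro vec.subspace_sum vec.subspace_scale U) auto
    ultimately have "n t + nrc_vector 3 v t \<in> U"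
      by simp
    from vec.subspace_diff[OF U(1) this mem[of t]] have "nrc_vector 3 v t - l t *s c t \<in> U"
      by simp
    moreover have "v i \<in> A" if "i \<le> 3" for i
      unfolding v_def using coord_frame_mem[OF e]
      by (intro vec.subspace_sum[OF A] vec.subspace_scale[OF A]) simp
    then have "nrc_vector 3 v t \<in> A"
      unfolding nrc_vector_eq_sum by (intro vec.subspace_sum[OF A] vec.subspace_scale[OF A]) simp
    then have "nrc_vector 3 v t - l t *s c t \<in> A"
      using vec.subspace_diff[OF A] vec.subspace_scale[OF A c_mem] by blast
    ultimately have "nrc_vector 3 v t - l t *s c t \<in> U \<inter> A"
      by simp
    then show ?thesis
      unfolding U(2) by simp
  qed
  have inf: "M 3 j = (if j = 2 then l None else 0)" if "j \<le> 2" for j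
  proof -
    have "(\<Sum>j\<le>2. (M 3 j - (if j = 2 then l None else 0)) *s e j) = 0"
      using eq[of None] by (simp add: v_def sum_atMost_2 vec.scale_left_diff_distrib add_diff_eq)
    from coord_frame_coords_zero[OF e this that] show ?thesis
      by simp
  qed
  have fin: "M 0 j + M 1 j * \<theta> + M 2 j * \<theta>\<^sup>2 + M 3 j * \<theta> ^ 3 = l (Some \<theta>) * \<theta> ^ j" if "j \<le> 2" for j \<theta>
  proof -
    have "(\<Sum>j\<le>2. (M 0 j + M 1 j * \<theta> + M 2 j * \<theta>\<^sup>2 + M 3 j * \<theta> ^ 3 - l (Some \<theta>) * \<theta> ^ j) *s e j) =
        nrc_vector 3 v (Some \<theta>) - l (Some \<theta>) *s c (Some \<theta>)"
      by (simp add: v_def sum_atMost_2 sum_atMost_3 vec_eq_iff algebra_simps)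
    also have "\<dots> = 0"
      using eq[of "Some \<theta>"] by simp
    finally have "(\<Sum>j\<le>2. (M 0 j + M 1 j * \<theta> + M 2 j * \<theta>\<^sup>2 + M 3 j * \<theta> ^ 3 - l (Some \<theta>) * \<theta> ^ j) *s e j) = 0" .
    from coord_frame_coords_zero[OF e this that] show ?thesis
      by simp
  qed
  have l: "l (Some \<theta>) = M 0 0 + M 1 0 * \<theta> + M 2 0 * \<theta>\<^sup>2" for \<theta>
    using fin[of 0 \<theta>] inf[of 0] by simp
  \<comment> \<open>This is \<open>\<theta>\<close> times coordinate 0 minus coordinate 1; its cubic
    term kills the quadratic part of \<open>l\<close>.\<close>
  have "[:- M 0 1, M 0 0 - M 1 1, M 1 0 - M 2 1, M 2 0:] = 0"
  proof (rule poly_eq_0_if_all_zero)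
    show "poly [:- M 0 1, M 0 0 - M 1 1, M 1 0 - M 2 1, M 2 0:] \<theta> = 0" for \<theta>
      using fin[of 1 \<theta>] inf[of 1] unfolding l by (simp add: algebra_simps power2_eq_square)
  qed (use q in \<open>simp add: degree_pCons_eq_if\<close>)
  then have "M 2 0 = 0"
    by simp
  \<comment> \<open>This is coordinate 2 minus \<open>\<theta>\<^sup>2\<close> times coordinate 0;
    its cubic term fixes the value of \<open>l\<close> at infinity.\<close>
  have "[:M 0 2, M 1 2, M 2 2 - M 0 0, M 3 2 - M 1 0:] = 0"
  proof (rule poly_eq_0_if_all_zero)
    show "poly [:M 0 2, M 1 2, M 2 2 - M 0 0, M 3 2 - M 1 0:] \<theta> = 0" for \<theta>
      using fin[of 2 \<theta>] unfolding l \<open>M 2 0 = 0\<close> by (simp add: algebra_simps power2_eq_square power3_eq_cube)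
  qed (use q in \<open>simp add: degree_pCons_eq_if\<close>)
  then have "l None = M 1 0"
    using inf[of 2] by simp
  with l \<open>M 2 0 = 0\<close> have "l t = lin (M 0 0) (M 1 0) t" for t
    by (cases t) (simp_all add: lin_def)
  then have "l = lin (M 0 0) (M 1 0)" ..
  with that show ?thesis .
qed

text \<open>No point of the curve lies in \<open>A\<close>, so each can be scaled to have the form
  \<open>n s + l s *s c s\<close>. Every generator occurs, by injectivity of \<open>\<sigma>\<close>
  and finiteness, so \<open>l\<close> is defined for all parameters.\<close>

lemma directrix_if_disjoint:
  assumes g: "coord_frame 3 U g" and q: "CARD('a) \<ge> 4"
    and on: "\<And>t. \<exists>s. nrc_vector 3 g t \<in> gen s" and disj: "U \<inter> A = {0}"
  obtains a b where "range (nrc_point 3 g) = directrix a b"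
proof -
  note U = coord_frame_subspace[OF g]
  let ?m = "nrc_vector 3 g"
  have "\<exists>s x y. ?m t = x *s c s + y *s n s" for t
    using on mem_gen_iff by metis
  then obtain \<sigma> x y where m: "\<And>t. ?m t = x t *s c (\<sigma> t) + y t *s n (\<sigma> t)"
    by metis
  have y: "y t \<noteq> 0" for t
  proof
    assume "y t = 0"
    then have "?m t \<in> U \<inter> A"
      using m[of t] nrc_vector_mem[OF g, of t] vec.subspace_scale[OF A c_mem, of "x t" "\<sigma> t"] by simp
    then show False
      unfolding disj using nrc_vector_nonzero[OF g] by simp
  qed
  have "inj \<sigma>"
  proof (rule injI)
    fix s t
    assume st: "\<sigma> s = \<sigma> t"
    \<comment> \<open>For two points on one generator this combination eliminates
      \<open>n (\<sigma> t)\<close> and leaves a vector of \<open>U \<inter> A\<close>.\<close>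
    have "y t *s ?m s - y s *s ?m t = (y t * x s - y s * x t) *s c (\<sigma> t)"
      unfolding m st by (simp add: vec_eq_iff algebra_simps)
    then have "y t *s ?m s - y s *s ?m t \<in> A"
      using vec.subspace_scale[OF A c_mem] by metis
    moreover have "y t *s ?m s - y s *s ?m t \<in> U"
      by (intro vec.subspace_diff U vec.subspace_scale nrc_vector_mem[OF g])
    ultimately have "y t *s ?m s - y s *s ?m t \<in> U \<inter> A"
      by simp
    then have "y t *s ?m s = y s *s ?m t"
      unfolding disj by simp
    then show "s = t"
      using nrc_vector_scale_eq[OF g _ _ y] by simp
  qed
  then have "surj \<sigma>"
    by (simp add: finite_UNIV_inj_surj)
  define l where "l s = x (inv \<sigma> s) / y (inv \<sigma> s)" for s
  have scaled: "n (\<sigma> t) + l (\<sigma> t) *s c (\<sigma> t) = (1 / y t) *s ?m t" for t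
    unfolding m l_def using y[of t] \<open>inj \<sigma>\<close> by (simp add: vec_eq_iff field_simps)
  have "n s + l s *s c s \<in> U" for s
  proof -
    obtain t where "s = \<sigma> t"
      using \<open>surj \<sigma>\<close> by (rule surjE)
    then show ?thesis
      using scaled[of t] vec.subspace_scale[OF U nrc_vector_mem[OF g]] by simp
  qed
  from lin_if_on_disjoint_subspace[OF U disj q this] obtain a b where l: "l = lin a b" .
  have "nrc_point 3 g t = nrc_point 3 (directrix_frame a b) (\<sigma> t)" for t
  proof -
    have "nrc_vector 3 (directrix_frame a b) (\<sigma> t) = (1 / y t) *s ?m t"
      using scaled[of t] unfolding nrc_vector_directrix_frame l .
    then show ?thesis
      unfolding nrc_point_def using span_singleton_scale[of "1 / y t" "?m t"] y[of t] by simp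
  qed
  then have "range (nrc_point 3 g) = nrc_point 3 (directrix_frame a b) ` range \<sigma>"
    by (simp add: image_image)
  with \<open>surj \<sigma>\<close> that show ?thesis
    by simp
qed

section \<open>The set of all twisted cubics on the surface\<close>

lemma gen_eq_span_points: "vec.span (nrc_point 2 e t \<union> nrc_point 3 f t) = gen t"
  unfolding gen_def nrc_point_def
proof (rule antisym)
  show "vec.span (vec.span {c t} \<union> vec.span {n t}) \<subseteq> vec.span {c t, n t}"
    by (intro vec.span_minimal vec.subspace_span Un_least) (simp_all add: vec.span_base)
  show "vec.span {c t, n t} \<subseteq> vec.span (vec.span {c t} \<union> vec.span {n t})"
    by (intro vec.span_mono) (simp add: vec.span_base)
qed

definition surface :: "('a ^ 'n) set set" where
  "surface = (\<Union>t. proj_points (gen t))"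

text \<open>The spanning space \<open>U\<close> is kept, since it serves as the 3-space disjoint
  from the plane of the conic.\<close>

lemma twisted_cubic_on_surfaceE:
  assumes q: "CARD('a) \<ge> 6" and N: "twisted_cubic N" "N \<subseteq> surface"
  obtains U a b where "proj_space 3 U" "U \<inter> A = {0}" "N \<subseteq> proj_points U" "N = directrix a b"
proof -
  obtain U g where U: "proj_space 3 U" and g: "coord_frame 3 U g" and N_eq: "N = range (nrc_point 3 g)"
    using N(1) unfolding twisted_cubic_def normal_rational_curve_def by auto
  have on: "\<exists>s. nrc_vector 3 g t \<in> gen s" for t
  proof -
    have "nrc_point 3 g t \<in> surface"
      using N(2) N_eq by auto
    then show ?thesis
      unfolding surface_def using nrc_point_in_proj_points_iff[OF g subspace_gen] by auto
  qed
  from disjoint_if_cubic_on_surface[OF g q on] have disj: "U \<inter> A = {0}" .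
  have "CARD('a) \<ge> 4"
    using q by simp
  from directrix_if_disjoint[OF g this on disj] obtain a b where "N = directrix a b"
    unfolding N_eq .
  moreover have "N \<subseteq> proj_points U"
    unfolding N_eq
    using nrc_point_in_proj_points_iff[OF g coord_frame_subspace[OF g]] nrc_vector_mem[OF g] by auto
  ultimately show ?thesis
    using that U disj by simp
qed

lemma directrix_twisted_cubic: "twisted_cubic (directrix a b)"
  unfolding twisted_cubic_def normal_rational_curve_def proj_space_def
  using coord_frame_directrix coord_frame_subspace[OF coord_frame_directrix]
    coord_frame_dim[OF coord_frame_directrix] by metis

lemma directrix_subset_surface: "directrix a b \<subseteq> surface"
proof (rule image_subsetI)
  fix t
  have "nrc_point 3 (directrix_frame a b) t \<in> proj_points (gen t)"
    using directrix_point_on_gen_iff[of "nrc_point 3 (directrix_frame a b) t" a b t] by simp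
  then show "nrc_point 3 (directrix_frame a b) t \<in> surface"
    unfolding surface_def by auto
qed

lemma twisted_cubics_on_surface:
  assumes "CARD('a) \<ge> 6"
  shows "{N. twisted_cubic N \<and> N \<subseteq> surface} = range (\<lambda>(a, b). directrix a b)"
proof (rule antisym; rule subsetI)
  fix N
  assume "N \<in> {N. twisted_cubic N \<and> N \<subseteq> surface}"
  then obtain a b where "N = directrix a b"
    using twisted_cubic_on_surfaceE[OF assms] by (metis mem_Collect_eq)
  then show "N \<in> range (\<lambda>(a, b). directrix a b)"
    by (intro image_eqI[of _ _ "(a, b)"]) simp_all
next
  fix N
  assume "N \<in> range (\<lambda>(a, b). directrix a b)"
  then obtain a b where "N = directrix a b"
    by auto
  then show "N \<in> {N. twisted_cubic N \<and> N \<subseteq> surface}"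
    using directrix_twisted_cubic directrix_subset_surface by simp
qed

end

section \<open>Transfer to an arbitrary ruled quintic surface\<close>

theorem theorem3p2:
  fixes \<alpha> :: "('a::{field,finite} ^ 7) set" and G V :: "('a ^ 7) set set"
  assumes "CARD('a) \<ge> 6"
    and "ruled_quintic_surface \<alpha> G V"
  shows "card {N. twisted_cubic N \<and> N \<subseteq> V} = CARD('a)\<^sup>2 \<and>
    (\<forall>N. twisted_cubic N \<and> N \<subseteq> V \<longrightarrow>
       (\<exists>S. proj_space 3 S \<and> proj_points S \<inter> proj_points \<alpha> = {} \<and> N \<subseteq> proj_points S) \<and>
       (\<forall>l\<in>G. \<exists>!P. P \<in> N \<and> P \<in> proj_points l))"
proof -
  obtain S e f' \<phi> where \<alpha>: "proj_space 2 \<alpha>" and S: "proj_space 3 S"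
    and "proj_points \<alpha> \<inter> proj_points S = {}"
    and e: "coord_frame 2 \<alpha> e" and f': "coord_frame 3 S f'" and \<phi>: "\<phi> \<in> PGL2"
    and G: "G = generators e f' \<phi>" and V: "V = (\<Union>l\<in>G. proj_points l)"
    using assms(2) unfolding ruled_quintic_surface_def by auto
  then have disj: "\<alpha> \<inter> S = {0}"
    using proj_points_subspace_disjoint_iff unfolding proj_space_def by blast
  \<comment> \<open>Changing the frame of \<open>S\<close> absorbs \<open>\<phi>\<close>.\<close>
  obtain f where f: "coord_frame 3 S f" and points: "\<And>t. nrc_point 3 f t = nrc_point 3 f' (\<phi> t)"
    using nrc_reparam[OF f' _ \<phi>] assms(1) by auto
  interpret conic_cubic_frames \<alpha> S e f
    using e f disj by unfold_locales
  have G_eq: "G = range gen"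
    unfolding G generators_def points[symmetric] gen_eq_span_points ..
  then have V_eq: "V = surface"
    unfolding V surface_def by auto
  \<comment> \<open>The cubics correspond bijectively to the pairs \<open>(a, b)\<close>.\<close>
  have "card {N. twisted_cubic N \<and> N \<subseteq> V} = CARD('a \<times> 'a)"
    unfolding V_eq twisted_cubics_on_surface[OF assms(1)] by (rule card_image[OF inj_directrix])
  then have "card {N. twisted_cubic N \<and> N \<subseteq> V} = CARD('a)\<^sup>2"
    by (simp add: power2_eq_square)
  moreover have "(\<exists>S. proj_space 3 S \<and> proj_points S \<inter> proj_points \<alpha> = {} \<and> N \<subseteq> proj_points S) \<and>
       (\<forall>l\<in>G. \<exists>!P. P \<in> N \<and> P \<in> proj_points l)" if N: "twisted_cubic N" "N \<subseteq> V" for N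
  proof -
    obtain U a b where U: "proj_space 3 U" "U \<inter> \<alpha> = {0}" "N \<subseteq> proj_points U" and N_eq: "N = directrix a b"
      using twisted_cubic_on_surfaceE[OF assms(1) N(1) N(2)[unfolded V_eq]] by metis
    have "proj_points U \<inter> proj_points \<alpha> = {}"
      using U(1,2) \<alpha> proj_points_subspace_disjoint_iff unfolding proj_space_def by blast
    moreover have "\<exists>!P. P \<in> N \<and> P \<in> proj_points (gen t)" for t
      unfolding N_eq directrix_point_on_gen_iff by simp
    ultimately show ?thesis
      unfolding G_eq using U by auto
  qed
  ultimately show ?thesis
    by simp
qed

end
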